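(* Let $C_1,C_2\in\mathbb{C}$ and let $\alpha_0,\alpha_1\in\mathbb{C}$ with $\alpha_0+\alpha_1=1$. Consider the Hamiltonian system in two variables $t,s$ $$dq_i=\frac{\partial H_1}{\partial p_i}dt+\frac{\partial H_2}{\partial p_i}ds,\qquad dp_i=-\frac{\partial H_1}{\partial q_i}dt-\frac{\partial H_2}{\partial q_i}ds\qquad(i=1,2)$$ with $$\begin{aligned} H_1={}&q_1^2p_1+\tfrac32sp_1-\tfrac{C_1}{2}p_1+\alpha_0q_1-p_2^3+(C_1-3s)p_2^2+\Big(-3s^2+2C_1s+\tfrac t2-\tfrac{C_2}{2}\Big)p_2-\tfrac{q_2^2}{2}+p_1p_2,\\ H_2={}&\tfrac{p_1^2}{2}-\tfrac12(C_2-4C_1s+6s^2-t)p_1+(2\alpha_0+\alpha_1)q_2-p_1p_2^2+2q_1^2p_1p_2+2q_1p_1q_2+2\alpha_0q_1p_2+(C_1-3s)p_1p_2. \end{aligned}$$ Then the birational transformations $$\begin{aligned} x&=q_1,\qquad y=q_1^2+p_2+\tfrac{3s}{2}-\tfrac{C_1}{2},\qquad z=2q_1^3+2p_2q_1-(C_1-3s)q_1+q_2,\\ w&=6q_1^4+8p_2q_1^2+2q_1q_2-4(C_1-3s)q_1^2-p_2^2+p_1+\tfrac t2-C_1s+\tfrac{3s^2}{2}+\tfrac{C_1^2}{2}-\tfrac{C_2}{2} \end{aligned}$$ take this Hamiltonian system to a system of the form $$\begin{aligned} dx={}&y\,dt+\big(w-6yx^2+y(C_1-3s)\big)ds,\\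 dy={}&z\,dt+h_1(x,y,z,w)\,ds,\\ dz={}&w\,dt+h_2(x,y,z,w)\,ds,\\ dw={}&\Big(10y^2x+10x^2z+2(C_1-3s)x^3-6x^5+\tfrac12(-3s^2+2C_1s+2t+C_1^2-2C_2)x-(C_1-3s)z-\alpha_0+\tfrac12\Big)dt+h_3(x,y,z,w)\,ds, \end{aligned}$$ for some $h_1,h_2,h_3\in\mathbb{C}(t,s)[x,y,z,w]$. *)

theory Defs
  imports "HOL-Analysis.Analysis" "HOL-Computational_Algebra.Polynomial"
    "HOL-Computational_Algebra.Fraction_Field"
begin

subsection \<open>Rational functions and polynomials\<close>

text \<open>
  The field \<open>\<complex>(t,s)\<close> is the fraction field of \<open>\<complex>[t][s]\<close>; the outer indeterminate is \<open>s\<close>.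
  The type \<open>'k poly4\<close> is \<open>'k[v1][v2][v3][v4]\<close>; the outermost indeterminate is \<open>v4\<close>.
  So \<open>\<complex>(t,s)[x,y,z,w]\<close> is \<open>ratfun_ts poly4\<close>, and \<open>\<complex>(t,s)(x,y,z,w)\<close> is \<open>ratfun_ts poly4 fract\<close>.
\<close>

type_synonym ratfun_ts = "complex poly poly fract"
type_synonym 'k poly4 = "'k poly poly poly poly"
type_synonym 'a quad = "'a \<times> 'a \<times> 'a \<times> 'a"

text \<open>
  A ring homomorphism \<open>e\<close> from a domain into a field extends to those fractions that have a
  representation whose denominator is not mapped to \<open>0\<close>.  (The value does not depend on the
  representation.)  This is used both for evaluation at a point and for substitution.
\<close>

definition fract_regular :: "('a::idom \<Rightarrow> 'b::field) \<Rightarrow> 'a fract \<Rightarrow> bool" where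
  "fract_regular e r \<longleftrightarrow> (\<exists>a b. r = Fract a b \<and> e b \<noteq> 0)"

definition fract_value :: "('a::idom \<Rightarrow> 'b::field) \<Rightarrow> 'a fract \<Rightarrow> 'b" where
  "fract_value e r = (THE v. \<exists>a b. r = Fract a b \<and> e b \<noteq> 0 \<and> v = e a / e b)"

definition eval_ts :: "complex \<Rightarrow> complex \<Rightarrow> complex poly poly \<Rightarrow> complex" where
  "eval_ts t s P = poly (poly P [:s:]) t"

text \<open>Evaluation of a polynomial in four variables, with \<open>e\<close> applied to the coefficients.\<close>

definition eval4 :: "('k::zero \<Rightarrow> 'b::comm_ring_1) \<Rightarrow> 'b quad \<Rightarrow> 'k poly4 \<Rightarrow> 'b" where
  "eval4 e = (\<lambda>(v1, v2, v3, v4) f.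
     poly (map_poly (\<lambda>f3. poly (map_poly (\<lambda>f2. poly (map_poly (\<lambda>f1.
       poly (map_poly e f1) v1) f2) v2) f3) v3) f) v4)"

definition coeffs_regular :: "complex \<Rightarrow> complex \<Rightarrow> ratfun_ts poly4 \<Rightarrow> bool" where
  "coeffs_regular t s f \<longleftrightarrow>
     (\<forall>i j k l. fract_regular (eval_ts t s) (coeff (coeff (coeff (coeff f l) k) j) i))"

definition eval_poly4 :: "complex \<Rightarrow> complex \<Rightarrow> complex quad \<Rightarrow> ratfun_ts poly4 \<Rightarrow> complex" where
  "eval_poly4 t s = eval4 (fract_value (eval_ts t s))"

subsection \<open>Birational transformations in four variables over a field\<close>

definition const4 :: "'k::field \<Rightarrow> 'k poly4 fract" where
  "const4 c = Fract [:[:[:[:c:]:]:]:] 1"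

definition vars4 :: "'k::field poly4 fract quad" where
  "vars4 = (Fract [:[:[:[:0, 1:]:]:]:] 1, Fract [:[:[:0, 1:]:]:] 1,
            Fract [:[:0, 1:]:] 1, Fract [:0, 1:] 1)"

text \<open>
  \<open>is_comp1 g f r\<close> says that the composite rational map \<open>g \<circ> f\<close> is defined, i.e. that no
  denominator of \<open>g\<close> vanishes identically after the substitution of \<open>f\<close>, and equals \<open>r\<close>.
\<close>

definition is_comp1 :: "'k::field poly4 fract \<Rightarrow> 'k poly4 fract quad \<Rightarrow> 'k poly4 fract \<Rightarrow> bool" where
  "is_comp1 g f r \<longleftrightarrow>
     fract_regular (eval4 const4 f) g \<and> fract_value (eval4 const4 f) g = r"

definition is_comp4 ::
    "'k::field poly4 fract quad \<Rightarrow> 'k poly4 fract quad \<Rightarrow> 'k poly4 fract quad \<Rightarrow> bool" where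
  "is_comp4 = (\<lambda>(g1, g2, g3, g4) f (r1, r2, r3, r4).
     is_comp1 g1 f r1 \<and> is_comp1 g2 f r2 \<and> is_comp1 g3 f r3 \<and> is_comp1 g4 f r4)"

definition birational4 :: "'k::field poly4 fract quad \<Rightarrow> bool" where
  "birational4 f \<longleftrightarrow> (\<exists>g. is_comp4 g f vars4 \<and> is_comp4 f g vars4)"

subsection \<open>Total differential systems in \<open>t\<close> and \<open>s\<close>\<close>

fun scale4 :: "complex \<Rightarrow> complex quad \<Rightarrow> complex quad" where
  "scale4 c (a1, a2, a3, a4) = (c * a1, c * a2, c * a3, c * a4)"

text \<open>
  \<open>u\<close> solves \<open>du = A dt + B ds\<close> at all points of \<open>U\<close>.  The derivative is complex linear, so on an
  open set \<open>U\<close> these are the holomorphic solutions.  Taking \<open>U\<close> to be a single point, one gets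
  the system as a condition on 1-jets, independently of its integrability.
\<close>

definition solves_on ::
    "(complex \<Rightarrow> complex \<Rightarrow> complex quad \<Rightarrow> complex quad) \<Rightarrow>
     (complex \<Rightarrow> complex \<Rightarrow> complex quad \<Rightarrow> complex quad) \<Rightarrow>
     (complex \<times> complex) set \<Rightarrow> (complex \<times> complex \<Rightarrow> complex quad) \<Rightarrow> bool" where
  "solves_on A B U u \<longleftrightarrow> (\<forall>(t, s) \<in> U.
     (u has_derivative
        (\<lambda>(dt, ds). scale4 dt (A t s (u (t, s))) + scale4 ds (B t s (u (t, s))))) (at (t, s)))"

text \<open>Phase space coordinates are ordered \<open>(q1, p1, q2, p2)\<close>.\<close>

fun ham_field ::
    "(complex \<Rightarrow> complex \<Rightarrow> complex quad \<Rightarrow> complex) \<Rightarrow> complex \<Rightarrow> complex \<Rightarrow> complex quad \<Rightarrow> complex quad"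
  where
  "ham_field H t s (q1, p1, q2, p2) =
     (deriv (\<lambda>p. H t s (q1, p, q2, p2)) p1,
      - deriv (\<lambda>q. H t s (q, p1, q2, p2)) q1,
      deriv (\<lambda>p. H t s (q1, p1, q2, p)) p2,
      - deriv (\<lambda>q. H t s (q1, p1, q, p2)) q2)"

subsection \<open>The two Hamiltonians, the transformation and the new system\<close>

fun H1 :: "complex \<Rightarrow> complex \<Rightarrow> complex \<Rightarrow> complex \<Rightarrow> complex \<Rightarrow> complex quad \<Rightarrow> complex" where
  "H1 C1 C2 \<alpha>0 t s (q1, p1, q2, p2) =
     q1^2 * p1 + 3/2 * s * p1 - C1/2 * p1 + \<alpha>0 * q1 - p2^3 + (C1 - 3 * s) * p2^2
     + (- 3 * s^2 + 2 * C1 * s + t/2 - C2/2) * p2 - q2^2/2 + p1 * p2"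

fun H2 ::
    "complex \<Rightarrow> complex \<Rightarrow> complex \<Rightarrow> complex \<Rightarrow> complex \<Rightarrow> complex \<Rightarrow> complex quad \<Rightarrow> complex" where
  "H2 C1 C2 \<alpha>0 \<alpha>1 t s (q1, p1, q2, p2) =
     p1^2/2 - 1/2 * (C2 - 4 * C1 * s + 6 * s^2 - t) * p1 + (2 * \<alpha>0 + \<alpha>1) * q2 - p1 * p2^2
     + 2 * q1^2 * p1 * p2 + 2 * q1 * p1 * q2 + 2 * \<alpha>0 * q1 * p2 + (C1 - 3 * s) * p1 * p2"

text \<open>
  Polymorphic, so that the same formula gives the map on points of \<open>\<complex>\<^sup>4\<close> for given \<open>t\<close> and \<open>s\<close>
  and the tuple of elements of \<open>\<complex>(t,s)(q1,p1,q2,p2)\<close>.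
\<close>

fun transf :: "'a::field \<Rightarrow> 'a \<Rightarrow> 'a \<Rightarrow> 'a \<Rightarrow> 'a quad \<Rightarrow> 'a quad" where
  "transf C1 C2 t s (q1, p1, q2, p2) =
     (q1,
      q1^2 + p2 + 3 * s/2 - C1/2,
      2 * q1^3 + 2 * p2 * q1 - (C1 - 3 * s) * q1 + q2,
      6 * q1^4 + 8 * p2 * q1^2 + 2 * q1 * q2 - 4 * (C1 - 3 * s) * q1^2 - p2^2 + p1
        + t/2 - C1 * s + 3 * s^2/2 + C1^2/2 - C2/2)"

definition generic_transf :: "complex \<Rightarrow> complex \<Rightarrow> ratfun_ts poly4 fract quad" where
  "generic_transf C1 C2 =
     transf (const4 (Fract [:[:C1:]:] 1)) (const4 (Fract [:[:C2:]:] 1))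
       (const4 (Fract [:[:0, 1:]:] 1)) (const4 (Fract [:0, 1:] 1)) vars4"

fun new_t_field ::
    "complex \<Rightarrow> complex \<Rightarrow> complex \<Rightarrow> complex \<Rightarrow> complex \<Rightarrow> complex quad \<Rightarrow> complex quad" where
  "new_t_field C1 C2 \<alpha>0 t s (x, y, z, w) =
     (y, z, w,
      10 * y^2 * x + 10 * x^2 * z + 2 * (C1 - 3 * s) * x^3 - 6 * x^5
        + 1/2 * (- 3 * s^2 + 2 * C1 * s + 2 * t + C1^2 - 2 * C2) * x - (C1 - 3 * s) * z - \<alpha>0 + 1/2)"

fun new_s_field ::
    "complex \<Rightarrow> ratfun_ts poly4 \<Rightarrow> ratfun_ts poly4 \<Rightarrow> ratfun_ts poly4 \<Rightarrow>
     complex \<Rightarrow> complex \<Rightarrow> complex quad \<Rightarrow> complex quad" where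
  "new_s_field C1 h1 h2 h3 t s (x, y, z, w) =
     (w - 6 * y * x^2 + y * (C1 - 3 * s),
      eval_poly4 t s (x, y, z, w) h1, eval_poly4 t s (x, y, z, w) h2,
      eval_poly4 t s (x, y, z, w) h3)"

end

theory Submission
  imports Defs
begin

text \<open>
  The transformation is triangular and polynomial in all variables, including \<open>t\<close> and \<open>s\<close>.
  Hence it has a polynomial inverse, given by the same formula over \<open>\<complex>\<close> and over
  \<open>\<complex>(t,s)(x,y,z,w)\<close>, and 1-jets of solutions correspond via its total differential.  It remains to
  verify that this differential takes the two Hamiltonian vector fields to the new ones, where the
  polynomials \<open>h1, h2, h3\<close> are obtained by expressing the image of the second one in the new coordinates.
\<close>

subsection \<open>Ring homomorphisms and evaluation of polynomials\<close>

definition is_ring_hom :: "('a::comm_ring_1 \<Rightarrow> 'b::comm_ring_1) \<Rightarrow> bool" where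
  "is_ring_hom e \<longleftrightarrow> e 1 = 1 \<and> (\<forall>a b. e (a + b) = e a + e b) \<and> (\<forall>a b. e (a * b) = e a * e b)"

lemma is_ring_hom_0: "is_ring_hom e \<Longrightarrow> e 0 = 0"
  unfolding is_ring_hom_def by (metis add_cancel_left_left add_0)

lemma is_ring_hom_uminus:
  assumes "is_ring_hom e" shows "e (- a) = - e a"
proof -
  have "e (- a) + e a = e (- a + a)"
    using assms unfolding is_ring_hom_def by metis
  then show ?thesis
    using is_ring_hom_0[OF assms] by (simp add: eq_neg_iff_add_eq_0)
qed

lemma poly_map_poly_pCons:
  "e 0 = 0 \<Longrightarrow> poly (map_poly e (pCons a p)) v = e a + v * poly (map_poly e p) v"
  by (simp add: map_poly_pCons)

text \<open>Universal property of the polynomial ring: a homomorphism on coefficients and a value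
  for the indeterminate determine one on polynomials. Multiplicativity follows by induction on the
  first factor from additivity and the scalar case. Four applications give
  \<open>eval4\<close>.\<close>

lemma is_ring_hom_poly_map_poly:
  assumes e: "is_ring_hom e"
  shows "is_ring_hom (\<lambda>p. poly (map_poly e p) v)"
proof -
  let ?E = "\<lambda>p. poly (map_poly e p) v"
  note e0 = is_ring_hom_0[OF e]
  note pCons = poly_map_poly_pCons[of e, OF e0]
  have e_add: "e (a + b) = e a + e b" and e_mult: "e (a * b) = e a * e b" and e_1: "e 1 = 1" for a b
    using e by (auto simp: is_ring_hom_def)
  have add: "?E (p + q) = ?E p + ?E q" for p q
    by (induction p q rule: poly_induct2) (simp_all add: pCons e_add algebra_simps)
  have smult: "?E (smult a q) = e a * ?E q" for a q
    by (induction q) (simp_all add: pCons e_mult algebra_simps)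
  have mult: "?E (p * q) = ?E p * ?E q" for p q
    by (induction p) (simp_all add: pCons add smult e0 algebra_simps)
  have "?E 1 = 1"
    by (simp add: one_pCons pCons e_1)
  with add mult show ?thesis
    by (simp add: is_ring_hom_def)
qed

lemma is_ring_hom_eval4: "is_ring_hom e \<Longrightarrow> is_ring_hom (eval4 e v)"
  by (cases v) (simp add: eval4_def is_ring_hom_poly_map_poly)

lemma eval4_const:
  assumes "is_ring_hom e" shows "eval4 e v [:[:[:[:c:]:]:]:] = e c"
proof (cases v)
  case (fields v1 v2 v3 v4)
  then show ?thesis
    using is_ring_hom_0[OF assms] by (simp add: eval4_def map_poly_pCons)
qed

lemma eval4_vars:
  assumes "is_ring_hom e"
  shows "eval4 e (v1, v2, v3, v4) [:[:[:[:0, 1:]:]:]:] = v1"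
    and "eval4 e (v1, v2, v3, v4) [:[:[:0, 1:]:]:] = v2"
    and "eval4 e (v1, v2, v3, v4) [:[:0, 1:]:] = v3"
    and "eval4 e (v1, v2, v3, v4) [:0, 1:] = v4"
proof -
  have "e 0 = 0" "e 1 = 1"
    using assms is_ring_hom_0 by (auto simp: is_ring_hom_def)
  then show "eval4 e (v1, v2, v3, v4) [:[:[:[:0, 1:]:]:]:] = v1"
    and "eval4 e (v1, v2, v3, v4) [:[:[:0, 1:]:]:] = v2"
    and "eval4 e (v1, v2, v3, v4) [:[:0, 1:]:] = v3"
    and "eval4 e (v1, v2, v3, v4) [:0, 1:] = v4"
    by (simp_all add: eval4_def map_poly_pCons one_pCons)
qed

text \<open>Coefficients may be embedded by \<open>j\<close> and then evaluated by \<open>e\<close>.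
  Preservation of zero is what lets \<open>map_poly\<close> compose, so \<open>e\<close> may be the
  evaluation of fractions.\<close>

lemma eval4_map_poly:
  assumes "e 0 = 0" "j 0 = 0"
  shows "eval4 e v (map_poly (map_poly (map_poly (map_poly j))) g) = eval4 (e \<circ> j) v g"
proof (cases v)
  case (fields v1 v2 v3 v4)
  then show ?thesis
    using assms by (simp add: eval4_def map_poly_map_poly comp_def)
qed

text \<open>Two representations of a fraction satisfy \<open>a * b' = a' * b\<close>; applying
  \<open>e\<close> and dividing by the nonzero images of the denominators shows that the quotients
  agree, so the description in \<open>fract_value\<close> is unique.\<close>

lemma fract_value_Fract:
  fixes e :: "'a::idom \<Rightarrow> 'b::field"
  assumes e: "is_ring_hom e" and b: "e b \<noteq> 0"
  shows "fract_value e (Fract a b) = e a / e b"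
  unfolding fract_value_def
proof (rule the_equality)
  show "\<exists>a' b'. Fract a b = Fract a' b' \<and> e b' \<noteq> 0 \<and> e a / e b = e a' / e b'"
    using b by blast
next
  fix v assume "\<exists>a' b'. Fract a b = Fract a' b' \<and> e b' \<noteq> 0 \<and> v = e a' / e b'"
  then obtain a' b' where *: "Fract a b = Fract a' b'" "e b' \<noteq> 0" "v = e a' / e b'"
    by blast
  have "b \<noteq> 0" "b' \<noteq> 0"
    using b *(2) is_ring_hom_0[OF e] by auto
  with *(1) have "a * b' = a' * b"
    by (simp add: eq_fract)
  then have "e a * e b' = e a' * e b"
    using e unfolding is_ring_hom_def by metis
  with * b show "v = e a / e b"
    by (simp add: frac_eq_eq)
qed

subsection \<open>Composition of rational maps\<close>

lemma is_ring_hom_const4: "is_ring_hom (const4 :: 'k::field \<Rightarrow> _)"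
  by (simp add: is_ring_hom_def const4_def One_fract_def one_pCons)

text \<open>Replaces the definite description by a choice of representation, in which the closure
  rules below can be computed.\<close>

lemma is_comp1_iff:
  "is_comp1 g f r \<longleftrightarrow>
    (\<exists>a b. g = Fract a b \<and> eval4 const4 f b \<noteq> 0 \<and> r = eval4 const4 f a / eval4 const4 f b)"
  using fract_value_Fract[OF is_ring_hom_eval4[OF is_ring_hom_const4], of f]
  unfolding is_comp1_def fract_regular_def by blast

lemma is_comp1_Fract_1: "eval4 const4 f a = r \<Longrightarrow> is_comp1 (Fract a 1) f r"
  using is_ring_hom_eval4[OF is_ring_hom_const4, of f]
  unfolding is_comp1_iff is_ring_hom_def by (metis div_by_1 zero_neq_one)

lemma is_comp1_const4: "is_comp1 (const4 c) f (const4 c)"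
  by (subst const4_def) (intro is_comp1_Fract_1 eval4_const is_ring_hom_const4)

lemma is_comp1_one: "is_comp1 1 f 1"
  unfolding One_fract_def
  by (rule is_comp1_Fract_1)
    (use is_ring_hom_eval4[OF is_ring_hom_const4, of f] in \<open>simp add: is_ring_hom_def One_fract_def\<close>)

lemma is_comp1_add:
  assumes "is_comp1 g f r" "is_comp1 g' f r'"
  shows "is_comp1 (g + g') f (r + r')"
proof -
  let ?e = "eval4 const4 f"
  note e = is_ring_hom_eval4[OF is_ring_hom_const4, of f]
  obtain a b a' b' where *: "g = Fract a b" "?e b \<noteq> 0" "r = ?e a / ?e b"
    "g' = Fract a' b'" "?e b' \<noteq> 0" "r' = ?e a' / ?e b'"
    using assms unfolding is_comp1_iff by blast
  \<comment> \<open>The sum formula for \<open>Fract\<close> needs nonzero denominators, and these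
    are nonzero because their images are.\<close>
  then have "b \<noteq> 0" "b' \<noteq> 0"
    using is_ring_hom_0[OF e] by auto
  then have "g + g' = Fract (a * b' + a' * b) (b * b')"
    using * by simp
  moreover have "?e (b * b') = ?e b * ?e b'"
    and "?e (a * b' + a' * b) = ?e a * ?e b' + ?e a' * ?e b"
    using e unfolding is_ring_hom_def by auto
  moreover have "r + r' = (?e a * ?e b' + ?e a' * ?e b) / (?e b * ?e b')"
    using * by (simp add: add_frac_eq)
  ultimately show ?thesis
    unfolding is_comp1_iff using * by (metis no_zero_divisors)
qed

lemma is_comp1_mult:
  assumes "is_comp1 g f r" "is_comp1 g' f r'"
  shows "is_comp1 (g * g') f (r * r')"
proof -
  let ?e = "eval4 const4 f"
  note e = is_ring_hom_eval4[OF is_ring_hom_const4, of f]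
  obtain a b a' b' where *: "g = Fract a b" "?e b \<noteq> 0" "r = ?e a / ?e b"
    "g' = Fract a' b'" "?e b' \<noteq> 0" "r' = ?e a' / ?e b'"
    using assms unfolding is_comp1_iff by blast
  then have "g * g' = Fract (a * a') (b * b')" by simp
  moreover have "?e (b * b') = ?e b * ?e b'" "?e (a * a') = ?e a * ?e a'"
    using e unfolding is_ring_hom_def by auto
  moreover have "r * r' = (?e a * ?e a') / (?e b * ?e b')"
    using * by simp
  ultimately show ?thesis
    unfolding is_comp1_iff using * by (metis no_zero_divisors)
qed

lemma is_comp1_uminus:
  assumes "is_comp1 g f r"
  shows "is_comp1 (- g) f (- r)"
proof -
  let ?e = "eval4 const4 f"
  note e = is_ring_hom_eval4[OF is_ring_hom_const4, of f]
  obtain a b where *: "g = Fract a b" "?e b \<noteq> 0" "r = ?e a / ?e b"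
    using assms unfolding is_comp1_iff by blast
  then have "- g = Fract (- a) b" "- r = ?e (- a) / ?e b"
    using is_ring_hom_uminus[OF e] by simp_all
  with * show ?thesis
    unfolding is_comp1_iff by blast
qed

text \<open>The condition \<open>r \<noteq> 0\<close> says that the numerator does not vanish
  identically after substitution, so it can serve as the denominator of the inverse.\<close>

lemma is_comp1_inverse:
  assumes "is_comp1 g f r" "r \<noteq> 0"
  shows "is_comp1 (inverse g) f (inverse r)"
proof -
  let ?e = "eval4 const4 f"
  obtain a b where *: "g = Fract a b" "?e b \<noteq> 0" "r = ?e a / ?e b"
    using assms unfolding is_comp1_iff by blast
  then have "inverse g = Fract b a" "inverse r = ?e b / ?e a" "?e a \<noteq> 0"
    using assms(2) by auto
  then show ?thesis
    unfolding is_comp1_iff by blast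
qed

lemma is_comp1_diff:
  "is_comp1 g f r \<Longrightarrow> is_comp1 g' f r' \<Longrightarrow> is_comp1 (g - g') f (r - r')"
  using is_comp1_add[of g f r "- g'" "- r'"] is_comp1_uminus[of g' f r'] by simp

lemma is_comp1_divide:
  "is_comp1 g f r \<Longrightarrow> is_comp1 g' f r' \<Longrightarrow> r' \<noteq> 0 \<Longrightarrow> is_comp1 (g / g') f (r / r')"
  using is_comp1_mult[of g f r "inverse g'" "inverse r'"] is_comp1_inverse[of g' f r']
  by (simp add: divide_inverse)

lemma is_comp1_power: "is_comp1 g f r \<Longrightarrow> is_comp1 (g ^ n) f (r ^ n)"
  by (induction n) (simp_all add: is_comp1_one is_comp1_mult)

lemma is_comp1_numeral: "is_comp1 (numeral n) f (numeral n)"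
  by (induction n) (simp_all only: numeral.simps is_comp1_one is_comp1_add)

lemmas is_comp1_intros =
  is_comp1_const4 is_comp1_add is_comp1_mult is_comp1_diff is_comp1_divide is_comp1_power
  is_comp1_numeral

text \<open>The tuple \<open>vars4\<close> is the identity map, hence a left unit for
  composition.\<close>

lemma is_comp4_vars4: "is_comp4 vars4 f f"
proof (cases f)
  case (fields f1 f2 f3 f4)
  then show ?thesis
    by (simp add: is_comp4_def vars4_def is_comp1_Fract_1 eval4_vars[OF is_ring_hom_const4])
qed

subsection \<open>The inverse transformation\<close>

text \<open>The formulas of \<open>transf\<close> solved successively for \<open>p2\<close> from
  \<open>y\<close>, \<open>q2\<close> from \<open>z\<close> and \<open>p1\<close> from
  \<open>w\<close>; the result is listed in the phase space order.\<close>

fun inv_transf :: "'a::field \<Rightarrow> 'a \<Rightarrow> 'a \<Rightarrow> 'a \<Rightarrow> 'a quad \<Rightarrow> 'a quad" where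
  "inv_transf C1 C2 t s (x, y, z, w) =
     (let p2 = y - x^2 - 3 * s/2 + C1/2;
          q2 = z - 2 * x^3 - 2 * p2 * x + (C1 - 3 * s) * x
      in (x,
          w - 6 * x^4 - 8 * p2 * x^2 - 2 * x * q2 + 4 * (C1 - 3 * s) * x^2 + p2^2
            - t/2 + C1 * s - 3 * s^2/2 - C1^2/2 + C2/2,
          q2, p2))"

lemma inv_transf_transf: "inv_transf C1 C2 t s (transf C1 C2 t s q) = q"
  by (cases q) (simp add: Let_def)

lemma transf_inv_transf: "transf C1 C2 t s (inv_transf C1 C2 t s v) = v"
  by (cases v) (simp add: Let_def)

text \<open>Both formulas are built from constants and coordinates by field operations, with which
  composition commutes. The only divisor is 2, whence the first assumption.\<close>

lemma is_comp4_transf: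
  fixes f g :: "'k::field poly4 fract quad"
  assumes "(2 :: 'k poly4 fract) \<noteq> 0" "is_comp4 g f r"
  shows "is_comp4 (transf (const4 a) (const4 b) (const4 c) (const4 d) g) f
      (transf (const4 a) (const4 b) (const4 c) (const4 d) r)"
    and "is_comp4 (inv_transf (const4 a) (const4 b) (const4 c) (const4 d) g) f
      (inv_transf (const4 a) (const4 b) (const4 c) (const4 d) r)"
proof -
  obtain g1 g2 g3 g4 r1 r2 r3 r4 where *: "g = (g1, g2, g3, g4)" "r = (r1, r2, r3, r4)"
    by (cases g, cases r)
  then have comp: "is_comp1 g1 f r1" "is_comp1 g2 f r2" "is_comp1 g3 f r3" "is_comp1 g4 f r4"
    using assms(2) by (auto simp: is_comp4_def)
  show "is_comp4 (transf (const4 a) (const4 b) (const4 c) (const4 d) g) f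
      (transf (const4 a) (const4 b) (const4 c) (const4 d) r)"
    using assms(1) unfolding is_comp4_def * transf.simps prod.case
    by (intro conjI is_comp1_intros comp)
  show "is_comp4 (inv_transf (const4 a) (const4 b) (const4 c) (const4 d) g) f
      (inv_transf (const4 a) (const4 b) (const4 c) (const4 d) r)"
    using assms(1) unfolding is_comp4_def * inv_transf.simps prod.case Let_def
    by (intro conjI is_comp1_intros comp)
qed

lemma two_neq_0_fract: "(2 :: 'a::idom) \<noteq> 0 \<Longrightarrow> (2 :: 'a fract) \<noteq> 0"
proof -
  assume "(2 :: 'a) \<noteq> 0"
  moreover have eq: "(2 :: 'a fract) = Fract 2 1"
    unfolding one_add_one[symmetric] One_fract_def by simp
  ultimately show ?thesis
    unfolding eq Zero_fract_def by (simp add: eq_fract)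
qed

lemma two_neq_0_ratfun: "(2 :: ratfun_ts poly4 fract) \<noteq> 0"
proof -
  have "(2 :: ratfun_ts) \<noteq> 0"
    by (intro two_neq_0_fract) (simp add: numeral_poly)
  then show ?thesis
    by (intro two_neq_0_fract) (simp add: numeral_poly)
qed

lemma birational4_generic_transf: "birational4 (generic_transf C1 C2)"
proof -
  let ?c1 = "const4 (Fract [:[:C1:]:] 1)" and ?c2 = "const4 (Fract [:[:C2:]:] 1)"
    and ?t = "const4 (Fract [:[:0, 1:]:] 1)" and ?s = "const4 (Fract [:0, 1:] 1)"
  let ?g = "inv_transf ?c1 ?c2 ?t ?s vars4"
  \<comment> \<open>Substitution into a formula applied to \<open>vars4\<close> gives that formula
    applied to the substituted tuple. The composite is then the inverse formula at
    \<open>generic_transf C1 C2\<close>, which collapses to \<open>vars4\<close>.\<close>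
  have "is_comp4 ?g (generic_transf C1 C2) (inv_transf ?c1 ?c2 ?t ?s (generic_transf C1 C2))"
    by (intro is_comp4_transf two_neq_0_ratfun is_comp4_vars4)
  moreover have "is_comp4 (generic_transf C1 C2) ?g (transf ?c1 ?c2 ?t ?s ?g)"
    unfolding generic_transf_def by (intro is_comp4_transf two_neq_0_ratfun is_comp4_vars4)
  ultimately show ?thesis
    unfolding birational4_def by (metis generic_transf_def inv_transf_transf transf_inv_transf)
qed

subsection \<open>Polynomial functions in six variables\<close>

text \<open>The polynomial \<open>h\<close> is chosen before \<open>t\<close>, \<open>s\<close> and
  \<open>v\<close>, so dependence on \<open>t\<close> and \<open>s\<close> must come from its
  coefficients.\<close>

definition represented :: "(complex \<Rightarrow> complex \<Rightarrow> complex quad \<Rightarrow> complex) \<Rightarrow> bool" where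
  "represented F \<longleftrightarrow> (\<exists>h :: ratfun_ts poly4. \<forall>t s v. eval_poly4 t s v h = F t s v)"

definition polynomial6 :: "(complex \<Rightarrow> complex \<Rightarrow> complex quad \<Rightarrow> complex) \<Rightarrow> bool" where
  "polynomial6 F \<longleftrightarrow>
    (\<exists>g :: complex poly poly poly4. \<forall>t s v. eval4 (eval_ts t s) v g = F t s v)"

lemma is_ring_hom_eval_ts: "is_ring_hom (eval_ts t s)"
  by (simp add: is_ring_hom_def eval_ts_def)

text \<open>
  \<^term>\<open>fract_value (eval_ts t s)\<close> is not a ring homomorphism on the whole fraction field, so
  coefficients without denominators are evaluated before they are embedded into that field.
\<close>

lemma polynomial6_represented: "polynomial6 F \<Longrightarrow> represented F"
proof -
  assume "polynomial6 F"
  then obtain g :: "complex poly poly poly4"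
    where g: "\<And>t s v. eval4 (eval_ts t s) v g = F t s v"
    unfolding polynomial6_def by blast
  let ?j = "\<lambda>a :: complex poly poly. Fract a 1"
  have val: "fract_value (eval_ts t s) (Fract a 1) = eval_ts t s a" for t s a
    using is_ring_hom_eval_ts[of t s] by (simp add: fract_value_Fract is_ring_hom_def)
  have "fract_value (eval_ts t s) 0 = 0" for t s
    using val[of t s 0] is_ring_hom_0[OF is_ring_hom_eval_ts] by (simp add: Zero_fract_def)
  moreover have "fract_value (eval_ts t s) \<circ> ?j = eval_ts t s" for t s
    by (rule ext) (simp add: val)
  ultimately have
    "eval_poly4 t s v (map_poly (map_poly (map_poly (map_poly ?j))) g) = F t s v" for t s v
    unfolding eval_poly4_def g[symmetric]
    by (subst eval4_map_poly) (simp_all add: Zero_fract_def)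
  then show "represented F"
    unfolding represented_def by blast
qed

lemma polynomial6_const: "polynomial6 (\<lambda>t s v. c)"
  unfolding polynomial6_def
  \<comment> \<open>The two inner layers belong to \<open>t\<close> (innermost) and
    \<open>s\<close>, the four outer ones to the phase space variables.\<close>
  by (intro exI[of _ "[:[:[:[:[:[:c:]:]:]:]:]:]"])
    (simp add: eval4_const[OF is_ring_hom_eval_ts], simp add: eval_ts_def)

lemma polynomial6_t: "polynomial6 (\<lambda>t s v. t)"
  unfolding polynomial6_def
  by (intro exI[of _ "[:[:[:[:[:[:0, 1:]:]:]:]:]:]"])
    (simp add: eval4_const[OF is_ring_hom_eval_ts], simp add: eval_ts_def)

lemma polynomial6_s: "polynomial6 (\<lambda>t s v. s)"
  unfolding polynomial6_def
  by (intro exI[of _ "[:[:[:[:[:0, 1:]:]:]:]:]"])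
    (simp add: eval4_const[OF is_ring_hom_eval_ts], simp add: eval_ts_def)

lemma polynomial6_vars:
  "polynomial6 (\<lambda>t s v. fst v)" "polynomial6 (\<lambda>t s v. fst (snd v))"
  "polynomial6 (\<lambda>t s v. fst (snd (snd v)))" "polynomial6 (\<lambda>t s v. snd (snd (snd v)))"
  unfolding polynomial6_def split_paired_All fst_conv snd_conv
  by (rule exI, intro allI, rule eval4_vars[OF is_ring_hom_eval_ts])+

lemma polynomial6_add:
  assumes "polynomial6 F" "polynomial6 G"
  shows "polynomial6 (\<lambda>t s v. F t s v + G t s v)"
proof -
  have "eval4 (eval_ts t s) v (f + g) = eval4 (eval_ts t s) v f + eval4 (eval_ts t s) v g" for t s v f g
    using is_ring_hom_eval4[OF is_ring_hom_eval_ts] unfolding is_ring_hom_def by blast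
  moreover obtain f g where
    "\<And>t s v. eval4 (eval_ts t s) v f = F t s v" "\<And>t s v. eval4 (eval_ts t s) v g = G t s v"
    using assms unfolding polynomial6_def by blast
  ultimately show ?thesis
    unfolding polynomial6_def by (intro exI[of _ "f + g"]) simp
qed

lemma polynomial6_mult:
  assumes "polynomial6 F" "polynomial6 G"
  shows "polynomial6 (\<lambda>t s v. F t s v * G t s v)"
proof -
  have "eval4 (eval_ts t s) v (f * g) = eval4 (eval_ts t s) v f * eval4 (eval_ts t s) v g" for t s v f g
    using is_ring_hom_eval4[OF is_ring_hom_eval_ts] unfolding is_ring_hom_def by blast
  moreover obtain f g where
    "\<And>t s v. eval4 (eval_ts t s) v f = F t s v" "\<And>t s v. eval4 (eval_ts t s) v g = G t s v"
    using assms unfolding polynomial6_def by blast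
  ultimately show ?thesis
    unfolding polynomial6_def by (intro exI[of _ "f * g"]) simp
qed

lemma polynomial6_diff:
  assumes "polynomial6 F" "polynomial6 G"
  shows "polynomial6 (\<lambda>t s v. F t s v - G t s v)"
  using polynomial6_add[OF assms(1) polynomial6_mult[OF polynomial6_const[of "- 1"] assms(2)]]
  by simp

lemma polynomial6_power:
  assumes "polynomial6 F" shows "polynomial6 (\<lambda>t s v. F t s v ^ n)"
proof (induction n)
  case 0
  show ?case
    using polynomial6_const[of 1] by simp
next
  case (Suc n)
  show ?case
    using polynomial6_mult[OF assms Suc] by simp
qed

lemmas polynomial6_intros =
  polynomial6_const polynomial6_t polynomial6_s polynomial6_vars polynomial6_add polynomial6_mult
  polynomial6_diff polynomial6_power

subsection \<open>Total differentials\<close>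

text \<open>This is total differentiability, not mere existence of partial derivatives. Recording
  the coefficients of \<open>dt\<close> and \<open>ds\<close> as numbers turns the derivative rules
  into algebra.\<close>

definition has_partials ::
    "(complex \<times> complex \<Rightarrow> complex) \<Rightarrow> complex \<Rightarrow> complex \<Rightarrow> complex \<times> complex \<Rightarrow> bool" where
  "has_partials f a b p \<longleftrightarrow> (f has_derivative (\<lambda>h. fst h * a + snd h * b)) (at p)"

lemma has_partials_const: "has_partials (\<lambda>p. c) 0 0 p"
  by (simp add: has_partials_def)

lemma has_partials_t: "has_partials (\<lambda>p. fst p) 1 0 p"
  unfolding has_partials_def by (auto intro!: derivative_eq_intros)

lemma has_partials_s: "has_partials (\<lambda>p. snd p) 0 1 p"
  unfolding has_partials_def by (auto intro!: derivative_eq_intros)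

lemma has_partials_add:
  "has_partials f a b p \<Longrightarrow> has_partials g a' b' p \<Longrightarrow> has_partials (\<lambda>p. f p + g p) (a + a') (b + b') p"
  unfolding has_partials_def
  by (drule (1) has_derivative_add) (simp add: algebra_simps)

lemma has_partials_diff:
  "has_partials f a b p \<Longrightarrow> has_partials g a' b' p \<Longrightarrow> has_partials (\<lambda>p. f p - g p) (a - a') (b - b') p"
  unfolding has_partials_def
  by (drule (1) has_derivative_diff) (simp add: algebra_simps)

lemma has_partials_mult:
  "has_partials f a b p \<Longrightarrow> has_partials g a' b' p \<Longrightarrow>
   has_partials (\<lambda>p. f p * g p) (a * g p + f p * a') (b * g p + f p * b') p"
  unfolding has_partials_def
  by (drule (1) has_derivative_mult) (simp add: algebra_simps)

lemma has_partials_divide_const: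
  "has_partials f a b p \<Longrightarrow> has_partials (\<lambda>p. f p / c) (a / c) (b / c) p"
  using has_partials_mult[OF _ has_partials_const, of f a b p "1 / c"] by simp

lemma has_partials_power:
  "has_partials f a b p \<Longrightarrow>
   has_partials (\<lambda>p. f p ^ n) (of_nat n * f p ^ (n - 1) * a) (of_nat n * f p ^ (n - 1) * b) p"
  unfolding has_partials_def
  by (drule has_derivative_power[of _ _ _ _ n]) (simp add: algebra_simps)

lemmas has_partials_intros =
  has_partials_const has_partials_t has_partials_s has_partials_add has_partials_diff
  has_partials_mult has_partials_divide_const has_partials_power

text \<open>Lets the introduction rules compute the coefficients as schematic variables and leaves
  their comparison with the expected ones to algebra.\<close>

lemma has_partials_eq:
  "has_partials f a b p \<Longrightarrow> a = a' \<Longrightarrow> b = b' \<Longrightarrow> has_partials f a' b' p"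
  by simp

lemma has_derivative_quad_iff:
  "((\<lambda>p. (f1 p, f2 p, f3 p, f4 p)) has_derivative
      (\<lambda>(dt, ds). scale4 dt (a1, a2, a3, a4) + scale4 ds (b1, b2, b3, b4))) (at p) \<longleftrightarrow>
   has_partials f1 a1 b1 p \<and> has_partials f2 a2 b2 p \<and> has_partials f3 a3 b3 p \<and> has_partials f4 a4 b4 p"
  (is "(?f has_derivative ?D) _ \<longleftrightarrow> ?R")
proof -
  have D: "?D = (\<lambda>h. (fst h * a1 + snd h * b1, fst h * a2 + snd h * b2,
      fst h * a3 + snd h * b3, fst h * a4 + snd h * b4))"
    by (auto simp: fun_eq_iff)
  show ?thesis
  proof
    assume "(?f has_derivative ?D) (at p)"
    note 1 = this[unfolded D]
    note 2 = has_derivative_snd[OF 1, simplified]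
    note 3 = has_derivative_snd[OF 2, simplified]
    show ?R
      using has_derivative_fst[OF 1] has_derivative_fst[OF 2] has_derivative_fst[OF 3]
        has_derivative_snd[OF 3]
      by (simp add: has_partials_def)
  next
    assume ?R
    then show "(?f has_derivative ?D) (at p)"
      unfolding D has_partials_def by (intro has_derivative_Pair) auto
  qed
qed

text \<open>The coefficient of \<open>dt\<close> for the transformed 1-jet: the Jacobian of
  \<open>transf\<close> in phase space applied to the old coefficient, plus the explicit
  \<open>t\<close>-derivative, which is only the 1/2 from \<open>t/2\<close>. In
  \<open>transf_s_deriv\<close> the terms free of the \<open>b\<close>'s arise likewise from
  explicit \<open>s\<close>.\<close>

fun transf_t_deriv :: "complex \<Rightarrow> complex \<Rightarrow> complex quad \<Rightarrow> complex quad \<Rightarrow> complex quad" where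
  "transf_t_deriv C1 s (q1, p1, q2, p2) (a1, a2, a3, a4) =
     (a1, 2 * q1 * a1 + a4,
      6 * q1^2 * a1 + 2 * (a4 * q1 + p2 * a1) - (C1 - 3 * s) * a1 + a3,
      24 * q1^3 * a1 + 8 * (a4 * q1^2 + 2 * p2 * q1 * a1) + 2 * (a1 * q2 + q1 * a3)
        - 8 * (C1 - 3 * s) * q1 * a1 - 2 * p2 * a4 + a2 + 1/2)"

fun transf_s_deriv :: "complex \<Rightarrow> complex \<Rightarrow> complex quad \<Rightarrow> complex quad \<Rightarrow> complex quad" where
  "transf_s_deriv C1 s (q1, p1, q2, p2) (b1, b2, b3, b4) =
     (b1, 2 * q1 * b1 + b4 + 3/2,
      6 * q1^2 * b1 + 2 * (b4 * q1 + p2 * b1) - (C1 - 3 * s) * b1 + 3 * q1 + b3,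
      24 * q1^3 * b1 + 8 * (b4 * q1^2 + 2 * p2 * q1 * b1) + 2 * (b1 * q2 + q1 * b3)
        - 8 * (C1 - 3 * s) * q1 * b1 + 12 * q1^2 - 2 * p2 * b4 + b2 - C1 + 3 * s)"

text \<open>
  Each new coordinate is one old coordinate plus a polynomial in those already treated, so both
  implications follow from the product rule.
\<close>

lemma transf_has_derivative_iff:
  fixes u :: "complex \<times> complex \<Rightarrow> complex quad"
  shows "(u has_derivative (\<lambda>(dt, ds). scale4 dt a + scale4 ds b)) (at (t, s)) \<longleftrightarrow>
    ((\<lambda>(t, s). transf C1 C2 t s (u (t, s))) has_derivative
      (\<lambda>(dt, ds). scale4 dt (transf_t_deriv C1 s (u (t, s)) a) +
        scale4 ds (transf_s_deriv C1 s (u (t, s)) b))) (at (t, s))"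
proof -
  define q1 p1 q2 p2 where "q1 = (\<lambda>p. fst (u p))" and "p1 = (\<lambda>p. fst (snd (u p)))"
    and "q2 = (\<lambda>p. fst (snd (snd (u p))))" and "p2 = (\<lambda>p. snd (snd (snd (u p))))"
  have u: "u = (\<lambda>p. (q1 p, p1 p, q2 p, p2 p))"
    by (simp add: q1_def p1_def q2_def p2_def)
  obtain a1 a2 a3 a4 b1 b2 b3 b4 where ab: "a = (a1, a2, a3, a4)" "b = (b1, b2, b3, b4)"
    by (cases a, cases b)
  define y where "y = (\<lambda>p. q1 p^2 + p2 p + 3 * snd p/2 - C1/2)"
  define z where "z = (\<lambda>p. 2 * q1 p^3 + 2 * p2 p * q1 p - (C1 - 3 * snd p) * q1 p + q2 p)"
  define w where "w = (\<lambda>p. 6 * q1 p^4 + 8 * p2 p * q1 p^2 + 2 * q1 p * q2 p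
    - 4 * (C1 - 3 * snd p) * q1 p^2 - p2 p^2 + p1 p
    + fst p/2 - C1 * snd p + 3 * snd p^2/2 + C1^2/2 - C2/2)"
  have v: "(\<lambda>(t, s). transf C1 C2 t s (u (t, s))) = (\<lambda>p. (q1 p, y p, z p, w p))"
    by (auto simp: u y_def z_def w_def)
  \<comment> \<open>For the converse only the new coordinates are known to be differentiable;
    differentiability of the old ones is recovered in the order \<open>p2\<close>,
    \<open>q2\<close>, \<open>p1\<close>.\<close>
  have p2: "p2 = (\<lambda>p. y p - q1 p^2 - 3 * snd p/2 + C1/2)"
    by (simp add: y_def)
  have q2: "q2 = (\<lambda>p. z p - 2 * q1 p^3 - 2 * p2 p * q1 p + (C1 - 3 * snd p) * q1 p)"
    by (simp add: z_def)
  have p1: "p1 = (\<lambda>p. w p - 6 * q1 p^4 - 8 * p2 p * q1 p^2 - 2 * q1 p * q2 p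
    + 4 * (C1 - 3 * snd p) * q1 p^2 + p2 p^2
    - fst p/2 + C1 * snd p - 3 * snd p^2/2 - C1^2/2 + C2/2)"
    by (simp add: w_def)
  obtain y1 z1 w1 where Ta: "transf_t_deriv C1 s (u (t, s)) a = (a1, y1, z1, w1)"
    by (simp add: u ab)
  obtain y2 z2 w2 where Tb: "transf_s_deriv C1 s (u (t, s)) b = (b1, y2, z2, w2)"
    by (simp add: u ab)
  note T = Ta[unfolded u ab transf_t_deriv.simps prod.inject]
    Tb[unfolded u ab transf_s_deriv.simps prod.inject]
  show ?thesis (is "?L \<longleftrightarrow> ?R")
  proof
    assume ?L
    then have *: "has_partials q1 a1 b1 (t, s)" "has_partials p1 a2 b2 (t, s)"
      "has_partials q2 a3 b3 (t, s)" "has_partials p2 a4 b4 (t, s)"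
      unfolding u ab has_derivative_quad_iff by simp_all
    have "has_partials y y1 y2 (t, s)"
      unfolding y_def
      by (rule has_partials_eq, (rule has_partials_intros *)+)
        (use T in \<open>auto simp: algebra_simps\<close>)
    moreover have "has_partials z z1 z2 (t, s)"
      unfolding z_def
      by (rule has_partials_eq, (rule has_partials_intros *)+)
        (use T in \<open>auto simp: algebra_simps power2_eq_square\<close>)
    moreover have "has_partials w w1 w2 (t, s)"
      unfolding w_def
      by (rule has_partials_eq, (rule has_partials_intros *)+)
        (use T in \<open>auto simp: algebra_simps power2_eq_square\<close>)
    ultimately show ?R
      unfolding v Ta Tb has_derivative_quad_iff using * by simp
  next
    assume ?R
    then have *: "has_partials q1 a1 b1 (t, s)" "has_partials y y1 y2 (t, s)"
      "has_partials z z1 z2 (t, s)" "has_partials w w1 w2 (t, s)"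
      unfolding v Ta Tb has_derivative_quad_iff by simp_all
    have p2': "has_partials p2 a4 b4 (t, s)"
      unfolding p2
      by (rule has_partials_eq, (rule has_partials_intros *)+)
        (use T in \<open>auto simp: algebra_simps\<close>)
    have q2': "has_partials q2 a3 b3 (t, s)"
      unfolding q2
      by (rule has_partials_eq, (rule has_partials_intros * p2')+)
        (use T in \<open>auto simp: algebra_simps power2_eq_square\<close>)
    have "has_partials p1 a2 b2 (t, s)"
      unfolding p1
      by (rule has_partials_eq, (rule has_partials_intros * p2' q2')+)
        (use T in \<open>auto simp: algebra_simps power2_eq_square\<close>)
    with * p2' q2' show ?L
      unfolding u ab has_derivative_quad_iff by simp
  qed
qed

subsection \<open>The transformed Hamiltonian system\<close>

text \<open>Matches the negated components of \<open>ham_field\<close>, so that the sign is absorbed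
  before differentiating.\<close>

lemma uminus_deriv_eq: "(f has_field_derivative - D) (at x) \<Longrightarrow> - deriv f x = D"
  by (simp add: DERIV_imp_deriv)

lemma ham_field_H1:
  "ham_field (H1 C1 C2 \<alpha>0) t s (q1, p1, q2, p2) =
    (q1^2 + 3/2 * s - C1/2 + p2, - (2 * q1 * p1 + \<alpha>0), - 3 * p2^2 + 2 * (C1 - 3 * s) * p2
      - 3 * s^2 + 2 * C1 * s + t/2 - C2/2 + p1, q2)"
  unfolding ham_field.simps prod.inject H1.simps
  by (intro conjI; rule uminus_deriv_eq DERIV_imp_deriv;
      auto intro!: derivative_eq_intros simp: algebra_simps)

lemma ham_field_H2:
  "ham_field (H2 C1 C2 \<alpha>0 \<alpha>1) t s (q1, p1, q2, p2) =
    (p1 - 1/2 * (C2 - 4 * C1 * s + 6 * s^2 - t) - p2^2 + 2 * q1^2 * p2 + 2 * q1 * q2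
       + (C1 - 3 * s) * p2,
     - (4 * q1 * p1 * p2 + 2 * p1 * q2 + 2 * \<alpha>0 * p2),
     - 2 * p1 * p2 + 2 * q1^2 * p1 + 2 * \<alpha>0 * q1 + (C1 - 3 * s) * p1,
     - (2 * \<alpha>0 + \<alpha>1 + 2 * q1 * p1))"
  unfolding ham_field.simps prod.inject H2.simps
  by (intro conjI; rule uminus_deriv_eq DERIV_imp_deriv;
      auto intro!: derivative_eq_intros simp: algebra_simps)

text \<open>Along the flow of \<open>H1\<close> the coordinates \<open>y\<close>, \<open>z\<close>,
  \<open>w\<close> are the first three \<open>t\<close>-derivatives of \<open>q1\<close>. The fourth
  component is the resulting fourth-order equation, a polynomial identity in the old
  coordinates.\<close>

lemma transf_t_deriv_ham_field:
  "transf_t_deriv C1 s q (ham_field (H1 C1 C2 \<alpha>0) t s q) =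
    new_t_field C1 C2 \<alpha>0 t s (transf C1 C2 t s q)"
proof (cases q)
  case (fields q1 p1 q2 p2)
  show ?thesis
    unfolding fields ham_field_H1 transf_t_deriv.simps transf.simps new_t_field.simps prod.inject
    by (intro conjI; simp add: field_simps eval_nat_numeral)
qed

text \<open>Each of the last three components is the total \<open>t\<close>-derivative of the
  preceding one along \<open>new_t_field\<close>, as equality of the mixed derivatives of
  \<open>x\<close> requires. Here \<open>k\<close> is the coefficient of \<open>x\<close> in the
  fourth component of \<open>new_t_field\<close>.\<close>

definition new_s_deriv :: "complex \<Rightarrow> complex \<Rightarrow> complex \<Rightarrow> complex \<Rightarrow> complex \<Rightarrow> complex quad \<Rightarrow> complex quad" where
  "new_s_deriv C1 C2 \<alpha>0 t s = (\<lambda>(x, y, z, w).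
     let c = C1 - 3 * s; k = t - 3/2 * s^2 + s * C1 + C1^2/2 - C2
     in (w - 6 * y * x^2 + y * c,
         k * x + 2 * c * x^3 - 6 * x^5 + 4 * x^2 * z - 2 * x * y^2 - \<alpha>0 + 1/2,
         k * y + 6 * c * x^2 * y - 30 * x^4 * y + 4 * x^2 * w + 4 * x * y * z + x - 2 * y^3,
         k * (4 * x^3 + z) + c * (8 * x^5 + 2 * x^2 * z + 12 * x * y^2)
           - 4 * \<alpha>0 * x^2 - 24 * x^7 + 10 * x^4 * z - 80 * x^3 * y^2 + 2 * x^2
           + 12 * x * y * w + 4 * x * z^2 - 2 * y^2 * z + 2 * y))"

lemma transf_s_deriv_ham_field:
  assumes "\<alpha>0 + \<alpha>1 = 1"
  shows "transf_s_deriv C1 s q (ham_field (H2 C1 C2 \<alpha>0 \<alpha>1) t s q) =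
    new_s_deriv C1 C2 \<alpha>0 t s (transf C1 C2 t s q)"
proof (cases q)
  case (fields q1 p1 q2 p2)
  \<comment> \<open>This turns the coefficient \<open>2 * \<alpha>0 + \<alpha>1\<close> of
    \<open>q2\<close> in \<open>H2\<close> into \<open>\<alpha>0 + 1\<close>; with the explicit 3/2
    in the derivative of \<open>y\<close> it yields the constant
    \<open>- \<alpha>0 + 1/2\<close>.\<close>
  have "\<alpha>1 = 1 - \<alpha>0"
    using assms by (simp add: algebra_simps)
  show ?thesis
    unfolding fields ham_field_H2 transf_s_deriv.simps transf.simps new_s_deriv_def
      prod.inject prod.case Let_def \<open>\<alpha>1 = 1 - \<alpha>0\<close>
    by (intro conjI; simp add: field_simps eval_nat_numeral)
qed

lemma represented_new_s_deriv:
  "represented (\<lambda>t s v. fst (snd (new_s_deriv C1 C2 \<alpha>0 t s v)))"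
  "represented (\<lambda>t s v. fst (snd (snd (new_s_deriv C1 C2 \<alpha>0 t s v))))"
  "represented (\<lambda>t s v. snd (snd (snd (new_s_deriv C1 C2 \<alpha>0 t s v))))"
  \<comment> \<open>Through \<open>divide_inverse\<close>, division by 2 becomes multiplication by a
    constant, which the closure rules cover.\<close>
  unfolding new_s_deriv_def case_prod_unfold Let_def fst_conv snd_conv divide_inverse
  by (intro polynomial6_represented polynomial6_intros)+

text \<open>The equivalence of 1-jets holds at each point separately, so \<open>U\<close> may be any
  set, open or not, and compatibility of the two flows does not enter.\<close>

lemma solves_on_transf:
  assumes "\<And>t s q. new_t t s (transf C1 C2 t s q) = transf_t_deriv C1 s q (A t s q)"
    and "\<And>t s q. new_s t s (transf C1 C2 t s q) = transf_s_deriv C1 s q (B t s q)"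
  shows "solves_on A B U u \<longleftrightarrow> solves_on new_t new_s U (\<lambda>(t, s). transf C1 C2 t s (u (t, s)))"
  unfolding solves_on_def prod.case assms
  by (simp only: transf_has_derivative_iff[where u = u and ?C1.0 = C1 and ?C2.0 = C2])

theorem theorem4p3:
  fixes C1 C2 \<alpha>0 \<alpha>1 :: complex
  assumes "\<alpha>0 + \<alpha>1 = 1"
  shows "birational4 (generic_transf C1 C2) \<and>
    (\<exists>h1 h2 h3 :: ratfun_ts poly4. \<forall>U u.
       (\<forall>(t, s) \<in> U. coeffs_regular t s h1 \<and> coeffs_regular t s h2 \<and> coeffs_regular t s h3) \<longrightarrow>
       (solves_on (ham_field (H1 C1 C2 \<alpha>0)) (ham_field (H2 C1 C2 \<alpha>0 \<alpha>1)) U u \<longleftrightarrow>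
        solves_on (new_t_field C1 C2 \<alpha>0) (new_s_field C1 h1 h2 h3) U
          (\<lambda>(t, s). transf C1 C2 t s (u (t, s)))))"
proof -
  obtain h1 h2 h3 :: "ratfun_ts poly4" where h:
    "\<And>t s v. eval_poly4 t s v h1 = fst (snd (new_s_deriv C1 C2 \<alpha>0 t s v))"
    "\<And>t s v. eval_poly4 t s v h2 = fst (snd (snd (new_s_deriv C1 C2 \<alpha>0 t s v)))"
    "\<And>t s v. eval_poly4 t s v h3 = snd (snd (snd (new_s_deriv C1 C2 \<alpha>0 t s v)))"
    using represented_new_s_deriv[of C1 C2 \<alpha>0] unfolding represented_def by blast
  \<comment> \<open>The first components coincide by definition; the other three do by the choice of
    \<open>h1\<close>, \<open>h2\<close>, \<open>h3\<close>.\<close>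
  have "new_s_field C1 h1 h2 h3 t s v = new_s_deriv C1 C2 \<alpha>0 t s v" for t s v
    by (cases v) (simp add: h new_s_deriv_def Let_def)
  then have "new_s_field C1 h1 h2 h3 t s (transf C1 C2 t s q) =
      transf_s_deriv C1 s q (ham_field (H2 C1 C2 \<alpha>0 \<alpha>1) t s q)" for t s q
    by (simp add: transf_s_deriv_ham_field[OF assms])
  then have "solves_on (ham_field (H1 C1 C2 \<alpha>0)) (ham_field (H2 C1 C2 \<alpha>0 \<alpha>1)) U u \<longleftrightarrow>
      solves_on (new_t_field C1 C2 \<alpha>0) (new_s_field C1 h1 h2 h3) U
        (\<lambda>(t, s). transf C1 C2 t s (u (t, s)))" for U u
    by (intro solves_on_transf) (simp_all add: transf_t_deriv_ham_field)
  with birational4_generic_transf show ?thesis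
    by blast
qed

end
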